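(* Let $G=G(n,\tfrac12)$ be the Erdős–Rényi random graph. Then asymptotically almost surely (i.e. with probability tending to $1$ as $n\to\infty$), \[\lambda_1^2(G)+\lambda_2^2(G) \le \sum_{e\in E(G)}2\left(1-\frac{1}{c(e)}\right).\]
   Context: $G(n,p)$ is the random graph on $n$ labelled vertices in which each pair is an edge independently with probability $p$. $\lambda_1\ge\lambda_2$ are the two largest adjacency eigenvalues. For an edge $e$, $c(e)$ is the order of the largest clique of $G$ containing $e$. *)

theory Defs
  imports
    "HOL-Probability.Probability"
    "HOL-Library.Ramsey"
    "Jordan_Normal_Form.Char_Poly"
begin

text \<open>A simple graph on the labelled vertex set \<open>{..<n}\<close> is represented by its edge set, a set of
  two-element subsets of \<open>{..<n}\<close>.\<close>

definition gnp :: "nat \<Rightarrow> real \<Rightarrow> nat set set pmf" where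
  "gnp n p = map_pmf (\<lambda>f. {e \<in> nsets {..<n} 2. f e})
               (Pi_pmf (nsets {..<n} 2) False (\<lambda>_. bernoulli_pmf p))"

definition adj_mat :: "nat \<Rightarrow> nat set set \<Rightarrow> real mat" where
  "adj_mat n E = mat n n (\<lambda>(i, j). if {i, j} \<in> E then 1 else 0)"

text \<open>The \<open>k\<close>-th largest adjacency eigenvalue for \<open>1 \<le> k \<le> n\<close>, counted with multiplicity. The
  matrix is real symmetric, so its characteristic polynomial splits over the reals. For other
  values of \<open>k\<close> the result is unspecified.\<close>

definition adj_eigenvalue :: "nat \<Rightarrow> nat set set \<Rightarrow> nat \<Rightarrow> real" where
  "adj_eigenvalue n E k =
     rev (sorted_list_of_multiset (proots (char_poly (adj_mat n E)))) ! (k - 1)"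

definition edge_clique_order :: "nat \<Rightarrow> nat set set \<Rightarrow> nat set \<Rightarrow> nat" where
  "edge_clique_order n E e = Max {card K |K. K \<subseteq> {..<n} \<and> clique K E \<and> e \<subseteq> K}"

end

theory Submission
  imports Defs "Jordan_Normal_Form.Schur_Decomposition"
begin

text \<open>
  Let \<open>A\<close> be the adjacency matrix. By Cauchy--Schwarz
  \<open>(\<lambda>\<^sub>1\<^sup>2 + \<lambda>\<^sub>2\<^sup>2)\<^sup>2 \<le> 2 (\<lambda>\<^sub>1\<^sup>4 + \<lambda>\<^sub>2\<^sup>4) \<le> 2 tr A\<^sup>4\<close>, and \<open>tr A\<^sup>4\<close> is the sum of the squared codegrees over
  all ordered pairs of vertices. By Hoeffding's inequality and a union bound, all codegrees of
  distinct vertices are asymptotically almost surely at most \<open>(1/4 + o(1)) n\<close>, hence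
  \<open>\<lambda>\<^sub>1\<^sup>2 + \<lambda>\<^sub>2\<^sup>2 \<le> (1/\<surd>8 + o(1)) n\<^sup>2\<close>. On the other side there are \<open>(1/4 - o(1)) n\<^sup>2\<close> edges and
  each of them lies in a 4-clique, so the sum over the edges is at least \<open>(3/8 - o(1)) n\<^sup>2\<close>.
  The claim follows from \<open>1/\<surd>8 < 3/8\<close>.
\<close>

section \<open>Real spectrum of symmetric matrices\<close>

text \<open>The Hermitian form \<open>S\<close> of the eigenvector \<open>x\<close> equals its own
  conjugate, by exchanging the two sums and using symmetry, so it is real. It also equals
  \<open>l * N\<close> with \<open>N\<close>, the squared norm of \<open>x\<close>,
  positive.\<close>

lemma real_symmetric_eigenvalue_real:
  fixes a :: "nat \<Rightarrow> nat \<Rightarrow> real" and x :: "nat \<Rightarrow> complex"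
  assumes sym: "\<And>i j. i < n \<Longrightarrow> j < n \<Longrightarrow> a i j = a j i"
    and ev: "\<And>i. i < n \<Longrightarrow> (\<Sum>j<n. of_real (a i j) * x j) = l * x i"
    and nz: "i0 < n" "x i0 \<noteq> 0"
  shows "l \<in> \<real>"
proof -
  define S where "S = (\<Sum>i<n. cnj (x i) * (\<Sum>j<n. of_real (a i j) * x j))"
  define N where "N = (\<Sum>i<n. (cmod (x i))\<^sup>2)"
  have S: "S = l * of_real N"
    unfolding S_def N_def using ev
    by (simp add: sum_distrib_left mult_ac complex_norm_square del: of_real_power)
  have "cnj S = (\<Sum>i<n. \<Sum>j<n. x i * (of_real (a i j) * cnj (x j)))"
    by (simp add: S_def sum_distrib_left)
  also have "\<dots> = (\<Sum>j<n. \<Sum>i<n. x i * (of_real (a i j) * cnj (x j)))"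
    by (rule sum.swap)
  also have "\<dots> = S"
    unfolding S_def sum_distrib_left by (intro sum.cong refl) (simp add: sym mult_ac)
  finally have "S \<in> \<real>" by (simp add: Reals_cnj_iff)
  moreover have "N > 0"
    unfolding N_def using nz by (intro sum_pos2[of _ i0]) auto
  ultimately show ?thesis
    using S by (metis Reals_divide Reals_of_real nonzero_mult_div_cancel_right of_real_eq_0_iff
        order_less_irrefl)
qed

text \<open>Over the complex numbers the polynomial factors, and every root has an eigenvector,
  hence is real. The factorization with roots \<open>Re a\<close> therefore maps to the complex one,
  and injectivity of the coefficient embedding brings it back to the reals.\<close>

lemma char_poly_symmetric_splits:
  fixes A :: "real mat"
  assumes A: "A \<in> carrier_mat n n"
    and sym: "\<And>i j. i < n \<Longrightarrow> j < n \<Longrightarrow> A $$ (i, j) = A $$ (j, i)"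
  obtains bs where "char_poly A = (\<Prod>b\<leftarrow>bs. [:- b, 1:])"
proof -
  define C :: "complex mat" where "C = map_mat of_real A"
  have C: "C \<in> carrier_mat n n" using A by (simp add: C_def)
  have cp: "char_poly C = map_poly of_real (char_poly A)"
    unfolding C_def by (rule of_real_hom.char_poly_hom[OF A])
  obtain as where as: "char_poly C = (\<Prod>a\<leftarrow>as. [:- a, 1:])"
    using char_poly_factorized[OF C] by blast
  have real: "a \<in> \<real>" if "a \<in> set as" for a
  proof -
    have "poly (char_poly C) a = 0"
      unfolding as poly_prod_list using that by (auto simp: prod_list_zero_iff)
    then obtain v where "eigenvector C v a"
      using eigenvalue_root_char_poly[OF C] unfolding eigenvalue_def by blast
    then have v: "v \<in> carrier_vec n" "v \<noteq> 0\<^sub>v n" and Cv: "C *\<^sub>v v = a \<cdot>\<^sub>v v"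
      using C by (auto simp: eigenvector_def)
    from v obtain i0 where i0: "i0 < n" "v $ i0 \<noteq> 0"
      by (metis carrier_vecD eq_vecI index_zero_vec)
    show ?thesis
    proof (rule real_symmetric_eigenvalue_real[of n "\<lambda>i j. A $$ (i, j)" "\<lambda>i. v $ i" a i0])
      fix i assume i: "i < n"
      have "(C *\<^sub>v v) $ i = (\<Sum>j<n. of_real (A $$ (i, j)) * v $ j)"
        using i A v C by (auto simp: C_def scalar_prod_def lessThan_atLeast0 intro!: sum.cong)
      with Cv v i show "(\<Sum>j<n. of_real (A $$ (i, j)) * v $ j) = a * v $ i" by simp
    qed (use sym i0 in auto)
  qed
  interpret hom: map_poly_inj_idom_hom "of_real :: real \<Rightarrow> complex" ..
  have "map_poly of_real (\<Prod>b\<leftarrow>map Re as. [:- b, 1:]) = (\<Prod>a\<leftarrow>as. [:- a, 1:])"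
    using real
  proof (induction as)
    case (Cons a as)
    have "map_poly of_real [:- Re a, 1:] = [:- a, 1:]"
      using Cons.prems[of a] by simp
    moreover have "map_poly of_real (\<Prod>b\<leftarrow>map Re as. [:- b, 1:]) = (\<Prod>a\<leftarrow>as. [:- a, 1:])"
      using Cons by simp
    ultimately show ?case
      by (simp only: list.map prod_list.Cons hom.hom_mult)
  qed simp
  then have "map_poly of_real (\<Prod>b\<leftarrow>map Re as. [:- b, 1:]) = (map_poly of_real (char_poly A) :: complex poly)"
    using as cp by simp
  then have "char_poly A = (\<Prod>b\<leftarrow>map Re as. [:- b, 1:])"
    by (metis hom.injectivity)
  then show ?thesis by (rule that)
qed

section \<open>Traces of matrix powers as power sums of eigenvalues\<close>

definition mat_trace :: "'a :: semiring_1 mat \<Rightarrow> 'a" where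
  "mat_trace A = (\<Sum>i<dim_row A. A $$ (i, i))"

lemma mat_trace_mult:
  assumes "A \<in> carrier_mat n m" "B \<in> carrier_mat m n"
  shows "mat_trace (A * B) = (\<Sum>i<n. \<Sum>j<m. A $$ (i, j) * B $$ (j, i))"
  unfolding mat_trace_def using assms
  by (auto simp: scalar_prod_def lessThan_atLeast0 intro!: sum.cong)

lemma mat_trace_commute:
  fixes A B :: "'a :: comm_semiring_1 mat"
  assumes "A \<in> carrier_mat n m" "B \<in> carrier_mat m n"
  shows "mat_trace (A * B) = mat_trace (B * A)"
  unfolding mat_trace_mult[OF assms] mat_trace_mult[OF assms(2,1)]
  by (subst sum.swap) (simp add: mult.commute)

text \<open>Cyclicity of the trace moves \<open>P\<close> next to \<open>Q\<close>, where the two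
  cancel.\<close>

lemma mat_trace_similar:
  fixes A B :: "'a :: comm_ring_1 mat"
  assumes "similar_mat_wit A B P Q"
  shows "mat_trace A = mat_trace B"
proof -
  define n where "n = dim_row A"
  have c: "A \<in> carrier_mat n n" "B \<in> carrier_mat n n" "P \<in> carrier_mat n n" "Q \<in> carrier_mat n n"
    and QP: "Q * P = 1\<^sub>m n" and A: "A = P * B * Q"
    using similar_mat_witD[OF n_def assms] by blast+
  have "mat_trace (P * B * Q) = mat_trace (Q * (P * B))"
    using c by (intro mat_trace_commute[of _ n n]) auto
  also have "Q * (P * B) = (Q * P) * B"
    using c by (simp add: assoc_mult_mat[of _ n n _ n _ n])
  also have "\<dots> = B" using c QP by simp
  finally show ?thesis using A by simp
qed

text \<open>In the sum over \<open>k\<close>, terms with \<open>k < i\<close> vanish because of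
  \<open>A\<close> and terms with \<open>k > j\<close> because of \<open>B\<close>; as
  \<open>j \<le> i\<close>, only \<open>k = i = j\<close> can survive. Treating the diagonal and the
  entries below it together gives triangularity and the diagonal of a product at once, as the
  induction on powers requires.\<close>

lemma upper_triangular_mult_diag:
  fixes A B :: "'a :: comm_ring_1 mat"
  assumes c: "A \<in> carrier_mat n n" "B \<in> carrier_mat n n"
    and u: "upper_triangular A" "upper_triangular B"
    and ij: "i < n" "j \<le> i"
  shows "(A * B) $$ (i, j) = (if i = j then A $$ (i, i) * B $$ (i, i) else 0)"
proof -
  have "(A * B) $$ (i, j) = (\<Sum>k<n. A $$ (i, k) * B $$ (k, j))"
    using c ij by (auto simp: scalar_prod_def lessThan_atLeast0 intro!: sum.cong)
  also have "\<dots> = (\<Sum>k<n. if k = i then if i = j then A $$ (i, i) * B $$ (i, i) else 0 else 0)"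
  proof (intro sum.cong refl)
    fix k assume k: "k \<in> {..<n}"
    have "A $$ (i, k) = 0" if "k < i" using u(1) c that ij by auto
    moreover have "B $$ (k, j) = 0" if "j < k" using u(2) c that k by auto
    ultimately show "A $$ (i, k) * B $$ (k, j)
        = (if k = i then if i = j then A $$ (i, i) * B $$ (i, i) else 0 else 0)"
      using ij by (cases k i rule: linorder_cases) auto
  qed
  finally show ?thesis using ij by simp
qed

lemma upper_triangular_pow:
  fixes B :: "'a :: comm_ring_1 mat"
  assumes c: "B \<in> carrier_mat n n" and u: "upper_triangular B"
  shows "upper_triangular (B ^\<^sub>m k) \<and> (\<forall>i<n. (B ^\<^sub>m k) $$ (i, i) = (B $$ (i, i)) ^ k)"
proof (induction k)
  case 0
  then show ?case using c by auto
next
  case (Suc k)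
  have ck: "B ^\<^sub>m k \<in> carrier_mat n n" using c by simp
  show ?case
    using Suc upper_triangular_mult_diag[OF ck c _ u] c ck
    by (auto simp: mult.commute)
qed

text \<open>Schur decomposition makes \<open>A\<close> similar to a triangular \<open>B\<close> with
  diagonal \<open>bs\<close>. Powers preserve the similarity and act entrywise on the diagonal of
  \<open>B\<close>.\<close>

lemma mat_trace_pow:
  fixes A :: "'a :: conjugatable_ordered_field mat"
  assumes A: "A \<in> carrier_mat n n" and cp: "char_poly A = (\<Prod>b\<leftarrow>bs. [:- b, 1:])"
  shows "mat_trace (A ^\<^sub>m k) = (\<Sum>b\<leftarrow>bs. b ^ k)"
proof -
  obtain B P Q where s: "schur_decomposition A bs = (B, P, Q)" by (cases "schur_decomposition A bs")
  from schur_decomposition[OF A cp s]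
  have sim: "similar_mat_wit A B P Q" and u: "upper_triangular B" and d: "diag_mat B = bs" by auto
  have B: "B \<in> carrier_mat n n" using similar_mat_witD2[OF A sim] by auto
  have "mat_trace (A ^\<^sub>m k) = mat_trace (B ^\<^sub>m k)"
    by (rule mat_trace_similar[OF similar_mat_wit_pow[OF sim]])
  also have "\<dots> = (\<Sum>i<n. (B $$ (i, i)) ^ k)"
    unfolding mat_trace_def using upper_triangular_pow[OF B u] B by simp
  also have "\<dots> = (\<Sum>b\<leftarrow>diag_mat B. b ^ k)"
    unfolding diag_mat_def using B
    by (simp add: interv_sum_list_conv_sum_set_nat lessThan_atLeast0 comp_def)
  finally show ?thesis using d by simp
qed

section \<open>The fourth moment of the spectrum in terms of codegrees\<close>

text \<open>The case \<open>i = j\<close> is included and gives the degree of \<open>i\<close>; such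
  diagonal entries also enter the trace and are bounded separately later.\<close>

definition codegree :: "nat \<Rightarrow> nat set set \<Rightarrow> nat \<Rightarrow> nat \<Rightarrow> nat" where
  "codegree n E i j = card {k \<in> {..<n}. {i, k} \<in> E \<and> {j, k} \<in> E}"

text \<open>The square of the adjacency matrix counts walks of length two, that is, common
  neighbours. It is symmetric, so the trace of its square is the sum of its squared entries.\<close>

lemma mat_trace_adj_mat_pow4:
  "mat_trace (adj_mat n E ^\<^sub>m 4) = (\<Sum>i<n. \<Sum>j<n. (real (codegree n E i j))\<^sup>2)"
proof -
  define A where "A = adj_mat n E"
  have A: "A \<in> carrier_mat n n" by (simp add: A_def adj_mat_def)
  have AA: "(A * A) $$ (i, j) = real (codegree n E i j)" if "i < n" "j < n" for i j
  proof -
    have "(A * A) $$ (i, j) = (\<Sum>k<n. if {i, k} \<in> E \<and> {j, k} \<in> E then 1 else 0)"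
      using that by (auto simp: A_def adj_mat_def scalar_prod_def lessThan_atLeast0 insert_commute
          intro!: sum.cong)
    then show ?thesis by (simp add: codegree_def sum.If_cases Int_def conj_commute)
  qed
  have "A ^\<^sub>m 4 = (A * A) * (A * A)"
    using A by (simp add: numeral_eq_Suc assoc_mult_mat[of _ n n _ n _ n])
  also have "mat_trace \<dots> = (\<Sum>i<n. \<Sum>j<n. (A * A) $$ (i, j) * (A * A) $$ (j, i))"
    using A by (intro mat_trace_mult) auto
  also have "\<dots> = (\<Sum>i<n. \<Sum>j<n. (real (codegree n E i j))\<^sup>2)"
    by (intro sum.cong refl) (simp add: AA power2_eq_square codegree_def conj_commute)
  finally show ?thesis by (simp add: A_def)
qed

text \<open>The right-hand side is the sum of the fourth powers of all eigenvalues; those other than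
  the first two contribute nonnegative terms and are dropped.\<close>

lemma adj_eigenvalue_pow4_le:
  assumes "n \<ge> 2"
  shows "(adj_eigenvalue n E 1) ^ 4 + (adj_eigenvalue n E 2) ^ 4
           \<le> (\<Sum>i<n. \<Sum>j<n. (real (codegree n E i j))\<^sup>2)"
proof -
  define A where "A = adj_mat n E"
  have A: "A \<in> carrier_mat n n" by (simp add: A_def adj_mat_def)
  have "A $$ (i, j) = A $$ (j, i)" if "i < n" "j < n" for i j
    using that by (simp add: A_def adj_mat_def insert_commute)
  then obtain bs where bs: "char_poly A = (\<Prod>b\<leftarrow>bs. [:- b, 1:])"
    using char_poly_symmetric_splits[OF A] by blast
  \<comment> \<open>This links the two descriptions of the spectrum: the sorted list behind
    \<open>adj_eigenvalue\<close> is a rearrangement of the factor list \<open>bs\<close> that the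
    trace formula uses.\<close>
  have "proots (\<Prod>b\<leftarrow>bs. [:- b, 1:]) = mset bs"
  proof (induction bs)
    case (Cons b bs)
    have "(\<Prod>b\<leftarrow>bs. [:- b, 1:]) \<noteq> 0" by (auto simp: prod_list_zero_iff)
    then have "proots ([:- b, 1:] * (\<Prod>b\<leftarrow>bs. [:- b, 1:])) = {#b#} + mset bs"
      using Cons by (subst proots_mult) (auto simp del: mult_pCons_left)
    then show ?case by (simp del: mult_pCons_left)
  qed simp
  then have pr: "proots (char_poly A) = mset bs" by (simp add: bs)
  define L where "L = rev (sorted_list_of_multiset (proots (char_poly A)))"
  have mL: "mset L = mset bs" by (simp add: L_def pr)
  have "length bs = n"
    using degree_monic_char_poly[OF A] degree_linear_factors[of uminus bs] bs by simp
  then have "length L = n" using mL by (metis size_mset)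
  \<comment> \<open>\<open>n \<ge> 2\<close> makes positions 0 and 1 valid; these are the ones read
    by \<open>adj_eigenvalue\<close> for \<open>k = 1\<close> and \<open>k = 2\<close>.\<close>
  then obtain x y zs where L: "L = x # y # zs"
    using assms by (auto simp: numeral_2_eq_2 Suc_le_length_iff)
  have "(\<Sum>b\<leftarrow>L. b ^ 4) = (\<Sum>b\<leftarrow>bs. b ^ 4)"
    using arg_cong[OF mL, of "\<lambda>M. \<Sum>b\<in>#M. b ^ 4"]
    by (simp flip: mset_map add: sum_mset_sum_list del: mset_map)
  also have "\<dots> = (\<Sum>i<n. \<Sum>j<n. (real (codegree n E i j))\<^sup>2)"
    using mat_trace_pow[OF A bs, of 4] by (simp add: A_def mat_trace_adj_mat_pow4)
  finally have "x ^ 4 + y ^ 4 + (\<Sum>b\<leftarrow>zs. b ^ 4) = (\<Sum>i<n. \<Sum>j<n. (real (codegree n E i j))\<^sup>2)"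
    by (simp add: L)
  moreover have "(\<Sum>b\<leftarrow>zs. b ^ 4) \<ge> 0" by (intro sum_list_nonneg) auto
  moreover have "adj_eigenvalue n E 1 = x" "adj_eigenvalue n E 2 = y"
    unfolding adj_eigenvalue_def A_def[symmetric] L_def[symmetric] by (simp_all add: L)
  ultimately show ?thesis by simp
qed

section \<open>Concentration for edge-disjoint patterns in the random graph\<close>

lemma set_pmf_gnp: "set_pmf (gnp n p) \<subseteq> Pow (nsets {..<n} 2)"
  by (auto simp: gnp_def)

text \<open>Patterns on disjoint edge sets of size \<open>s\<close> occur independently, each with
  probability \<open>p ^ s\<close>, so Hoeffding's inequality applies to their number. It is used
  below with \<open>s = 2\<close> for codegrees, \<open>s = 1\<close> for edges and
  \<open>s = 5\<close> for completions to a 4-clique.\<close>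

lemma gnp_count_tails:
  fixes S :: "'b \<Rightarrow> nat set set" and p \<epsilon> :: real
  assumes T: "finite T" "T \<noteq> {}"
    and S: "\<And>t. t \<in> T \<Longrightarrow> S t \<subseteq> nsets {..<n} 2" "\<And>t. t \<in> T \<Longrightarrow> card (S t) = s"
    and disj: "disjoint_family_on S T"
    and p: "0 \<le> p" "p \<le> 1" and \<epsilon>: "\<epsilon> \<ge> 0"
  shows "measure_pmf.prob (gnp n p) {E. real (card {t \<in> T. S t \<subseteq> E}) \<ge> (p ^ s + \<epsilon>) * real (card T)}
           \<le> exp (- 2 * \<epsilon>\<^sup>2 * real (card T))" (is ?upper)
    and "measure_pmf.prob (gnp n p) {E. real (card {t \<in> T. S t \<subseteq> E}) \<le> (p ^ s - \<epsilon>) * real (card T)}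
           \<le> exp (- 2 * \<epsilon>\<^sup>2 * real (card T))" (is ?lower)
proof -
  define I where "I = nsets {..<n} 2"
  define M where "M = Pi_pmf I False (\<lambda>_. bernoulli_pmf p)"
  define X :: "'b \<Rightarrow> (nat set \<Rightarrow> bool) \<Rightarrow> real" where "X = (\<lambda>t f. of_bool (\<forall>e\<in>S t. f e))"
  have I: "finite I" by (simp add: I_def finite_imp_finite_nsets)
  have finS: "finite (S t)" if "t \<in> T" for t
    using S(1)[OF that] I unfolding I_def by (rule finite_subset)
  have gnp: "gnp n p = map_pmf (\<lambda>f. {e \<in> I. f e}) M"
    by (simp add: gnp_def M_def I_def)
  have count: "real (card {t \<in> T. S t \<subseteq> {e \<in> I. f e}}) = (\<Sum>t\<in>T. X t f)" for f
  proof -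
    have "{t \<in> T. S t \<subseteq> {e \<in> I. f e}} = T \<inter> {t. \<forall>e\<in>S t. f e}"
      using S(1) by (auto simp: I_def)
    then show ?thesis by (simp add: X_def of_bool_def sum.If_cases T)
  qed
  have "measure_pmf.prob M {f. \<forall>e\<in>S t. f e} = p ^ s" if t: "t \<in> T" for t
  proof -
    \<comment> \<open>Written as a product set, the event has a probability that factors over the
      coordinates.\<close>
    have "{f. \<forall>e\<in>S t. f e} = Pi I (\<lambda>e. if e \<in> S t then {True} else UNIV)"
      using S(1)[OF t] by (auto simp: I_def Pi_def split: if_splits)
    also have "measure_pmf.prob M \<dots>
        = (\<Prod>e\<in>I. measure_pmf.prob (bernoulli_pmf p) (if e \<in> S t then {True} else UNIV))"
      unfolding M_def by (rule measure_Pi_pmf_Pi[OF I])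
    also have "\<dots> = (\<Prod>e\<in>I. if e \<in> S t then p else 1)"
      by (intro prod.cong refl) (auto simp: measure_pmf_single p)
    also have "\<dots> = (\<Prod>e\<in>I \<inter> S t. p)"
      by (simp only: prod.inter_restrict[OF I])
    also have "I \<inter> S t = S t" using S(1)[OF t] by (auto simp: I_def)
    finally show ?thesis using S(2)[OF t] by simp
  qed
  moreover have "X t = indicator {f. \<forall>e\<in>S t. f e}" for t
    by (auto simp: X_def indicator_def)
  ultimately have expect: "measure_pmf.expectation M (X t) = p ^ s" if "t \<in> T" for t
    using that by simp
  \<comment> \<open>Restrictions of \<open>f\<close> to disjoint coordinate sets are independent,
    and each \<open>X t\<close> is a measurable function of the restriction to
    \<open>S t\<close>.\<close>
  have indep: "prob_space.indep_vars (measure_pmf M) (\<lambda>_. borel) X T"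
  proof -
    have restr: "prob_space.indep_vars (measure_pmf M) (\<lambda>t. PiM (S t) (\<lambda>_. count_space UNIV))
        (\<lambda>t f. restrict (\<lambda>e. f e) (S t)) T"
      unfolding M_def
      by (rule prob_space.indep_vars_restrict[OF measure_pmf.prob_space_axioms
            indep_vars_Pi_pmf[OF I] _ disj]) (use S(1) in \<open>simp add: I_def\<close>)
    have meas: "(\<lambda>g. of_bool (\<forall>e\<in>S t. g e) :: real)
        \<in> borel_measurable (PiM (S t) (\<lambda>_. count_space UNIV))" if "t \<in> T" for t
    proof -
      have "countable (S t)" using finS[OF that] by (rule countable_finite)
      then show ?thesis by measurable
    qed
    show ?thesis
      using prob_space.indep_vars_compose2[OF measure_pmf.prob_space_axioms restr,
          where Y = "\<lambda>t g. of_bool (\<forall>e\<in>S t. g e)" and N = "\<lambda>_. borel", OF meas]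
      by (simp add: X_def)
  qed
  interpret H: Hoeffding_ineq "measure_pmf M" T X "\<lambda>_. 0" "\<lambda>_. 1" "\<Sum>t\<in>T. measure_pmf.expectation M (X t)"
  proof unfold_locales
    show "AE f in measure_pmf M. X t f \<in> {0..1}" for t by (simp add: X_def)
  qed (fact T indep)+
  have mean: "(\<Sum>t\<in>T. measure_pmf.expectation M (X t)) = p ^ s * real (card T)"
    by (simp add: expect)
  have pos: "real (card T) > 0" using T by (simp add: card_gt_0_iff)
  \<comment> \<open>Each variable ranges over an interval of length 1, so the denominator in
    Hoeffding's exponent is \<open>card T\<close>; the deviation is
    \<open>\<epsilon> * card T\<close>.\<close>
  then have expo: "- 2 * (\<epsilon> * real (card T))\<^sup>2 / real (card T) = - 2 * \<epsilon>\<^sup>2 * real (card T)"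
    by (simp add: power2_eq_square)
  show ?upper
    using H.Hoeffding_ineq_ge[of "\<epsilon> * real (card T)"] \<epsilon> pos expo mean
    by (simp add: gnp count measure_map_pmf vimage_def algebra_simps)
  show ?lower
    using H.Hoeffding_ineq_le[of "\<epsilon> * real (card T)"] \<epsilon> pos expo mean
    by (simp add: gnp count measure_map_pmf vimage_def algebra_simps)
qed

section \<open>Decay of the error term, and tails of the codegrees and the edge count\<close>

text \<open>The factor \<open>n\<close> squared is the cost of a union bound over pairs of vertices;
  \<open>a\<close> absorbs the constant shifts in the exponents. Substituting \<open>n / c\<close>
  reduces this to the standard limit of a power over the exponential.\<close>

lemma square_times_exp_tendsto_0:
  fixes a c :: real
  assumes c: "c > 0"
  shows "(\<lambda>n. (real n)\<^sup>2 * exp (- (real n - a) / c)) \<longlonglongrightarrow> 0"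
proof -
  have "filterlim (\<lambda>n. real n / c) at_top sequentially"
    using filterlim_tendsto_pos_mult_at_top[OF tendsto_const _ filterlim_real_sequentially, of "1/c"] c
    by simp
  from filterlim_compose[OF tendsto_power_div_exp_0[of 2] this]
  have "(\<lambda>n. c\<^sup>2 * exp (a / c) * ((real n / c)\<^sup>2 / exp (real n / c))) \<longlonglongrightarrow> 0"
    by (rule tendsto_mult_right_zero)
  moreover have "c\<^sup>2 * exp (a / c) * ((real n / c)\<^sup>2 / exp (real n / c))
      = (real n)\<^sup>2 * exp (- (real n - a) / c)" for n
    using c by (simp add: power_divide diff_divide_distrib exp_diff)
  ultimately show ?thesis by simp
qed

text \<open>A vertex \<open>k\<close> outside \<open>{i, j}\<close> is a common neighbour with
  probability 1/4, and different \<open>k\<close> involve disjoint pairs of edges. The bound takes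
  \<open>\<epsilon> = 1/200\<close>, as \<open>51/200 = 1/4 + 1/200\<close>, and
  \<open>20000\<close> comes from \<open>2 * (1/200)^2 = 1/20000\<close>.\<close>

lemma prob_codegree_large:
  assumes n: "n > 2" and ij: "i < n" "j < n" "i \<noteq> j"
  shows "measure_pmf.prob (gnp n (1/2)) {E. real (codegree n E i j) > 51/200 * real n}
           \<le> exp (- (real n - 2) / 20000)"
proof -
  define T where "T = {..<n} - {i, j}"
  define S where "S = (\<lambda>k. {{i, k}, {j, k}})"
  have cT: "card T = n - 2" unfolding T_def using ij by (subst card_Diff_subset) auto
  have "card T > 0" using cT n by simp
  then have T: "finite T" "T \<noteq> {}" by (simp_all add: card_gt_0_iff)
  have "card (S t) = 2" for t
    using ij by (auto simp: S_def card_2_iff doubleton_eq_iff)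
  moreover have "disjoint_family_on S T"
    by (auto simp: disjoint_family_on_def S_def T_def doubleton_eq_iff)
  moreover have "S t \<subseteq> nsets {..<n} 2" if "t \<in> T" for t
    using that ij by (auto simp: S_def T_def)
  ultimately have tail: "measure_pmf.prob (gnp n (1/2))
      {E. real (card {t \<in> T. S t \<subseteq> E}) \<ge> ((1/2) ^ 2 + 1/200) * real (card T)}
        \<le> exp (- 2 * (1/200)\<^sup>2 * real (card T))"
    by (intro gnp_count_tails T) auto
  have "measure_pmf.prob (gnp n (1/2)) {E. real (codegree n E i j) > 51/200 * real n}
      \<le> measure_pmf.prob (gnp n (1/2))
      {E. real (card {t \<in> T. S t \<subseteq> E}) \<ge> ((1/2) ^ 2 + 1/200) * real (card T)}"
  proof (rule measure_pmf.finite_measure_mono_AE)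
    show "AE E in gnp n (1/2). E \<in> {E. real (codegree n E i j) > 51/200 * real n} \<longrightarrow>
      E \<in> {E. real (card {t \<in> T. S t \<subseteq> E}) \<ge> ((1/2) ^ 2 + 1/200) * real (card T)}"
    proof (rule AE_pmfI)
      fix E assume "E \<in> set_pmf (gnp n (1/2))"
      then have "E \<subseteq> nsets {..<n} 2" using set_pmf_gnp by blast
      \<comment> \<open>Without loops neither \<open>i\<close> nor \<open>j\<close> is a common
        neighbour of the two, so counting over \<open>T\<close> misses nothing.\<close>
      then have "{a, a} \<notin> E" for a by (metis doubleton_in_nsets_2 subsetD)
      then have "{k \<in> {..<n}. {i, k} \<in> E \<and> {j, k} \<in> E} = {t \<in> T. S t \<subseteq> E}"
        by (auto simp: S_def T_def)
      moreover have "real (card T) \<le> real n" by (simp add: cT)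
      ultimately show "E \<in> {E. real (codegree n E i j) > 51/200 * real n} \<longrightarrow>
        E \<in> {E. real (card {t \<in> T. S t \<subseteq> E}) \<ge> ((1/2) ^ 2 + 1/200) * real (card T)}"
        by (simp add: codegree_def power2_eq_square)
    qed
  qed simp
  also note tail
  also have "- 2 * (1/200)\<^sup>2 * real (card T) = - (real n - 2) / 20000"
    using n by (simp add: cT of_nat_diff power2_eq_square field_simps)
  finally show ?thesis .
qed

text \<open>The patterns are single edges, again with \<open>\<epsilon> = 1/200\<close>:
  \<open>99/200 = 1/2 - 1/200\<close>.\<close>

lemma prob_few_edges:
  assumes n: "n \<ge> 2"
  shows "measure_pmf.prob (gnp n (1/2)) {E. real (card E) < 99/200 * real (n choose 2)}
           \<le> exp (- real (n choose 2) / 20000)"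
proof -
  define T where "T = nsets {..<n} 2"
  have cT: "card T = n choose 2"
    unfolding T_def binomial_eq_nsets atLeast0LessThan ..
  have T: "finite T" "T \<noteq> {}"
    using n by (auto simp: T_def finite_imp_finite_nsets nsets_eq_empty_iff)
  have tail: "measure_pmf.prob (gnp n (1/2))
      {E. real (card {t \<in> T. {t} \<subseteq> E}) \<le> ((1/2) ^ 1 - 1/200) * real (card T)}
        \<le> exp (- 2 * (1/200)\<^sup>2 * real (card T))"
    by (intro gnp_count_tails T) (auto simp: T_def disjoint_family_on_def)
  have "measure_pmf.prob (gnp n (1/2)) {E. real (card E) < 99/200 * real (n choose 2)}
      \<le> measure_pmf.prob (gnp n (1/2))
      {E. real (card {t \<in> T. {t} \<subseteq> E}) \<le> ((1/2) ^ 1 - 1/200) * real (card T)}"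
  proof (rule measure_pmf.finite_measure_mono_AE)
    show "AE E in gnp n (1/2). E \<in> {E. real (card E) < 99/200 * real (n choose 2)} \<longrightarrow>
      E \<in> {E. real (card {t \<in> T. {t} \<subseteq> E}) \<le> ((1/2) ^ 1 - 1/200) * real (card T)}"
    proof (rule AE_pmfI)
      fix E assume "E \<in> set_pmf (gnp n (1/2))"
      then have "{t \<in> T. {t} \<subseteq> E} = E" using set_pmf_gnp by (auto simp: T_def)
      then show "E \<in> {E. real (card E) < 99/200 * real (n choose 2)} \<longrightarrow>
        E \<in> {E. real (card {t \<in> T. {t} \<subseteq> E}) \<le> ((1/2) ^ 1 - 1/200) * real (card T)}"
        by (simp add: cT)
    qed
  qed simp
  also note tail
  also have "- 2 * (1/200)\<^sup>2 * real (card T) = - real (n choose 2) / 20000"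
    by (simp add: cT power2_eq_square)
  finally show ?thesis .
qed

section \<open>Completing a pair of vertices to a 4-clique\<close>

text \<open>The edges of the 4-clique on \<open>u, v, x, y\<close> other than \<open>{u, v}\<close>.
  Leaving out that shared edge allows completions of the same pair to be edge-disjoint.\<close>

definition K4_completion :: "'a \<Rightarrow> 'a \<Rightarrow> 'a \<Rightarrow> 'a \<Rightarrow> 'a set set" where
  "K4_completion u v x y = {{u, x}, {u, y}, {v, x}, {v, y}, {x, y}}"

lemma card_K4_completion: "distinct [u, v, x, y] \<Longrightarrow> card (K4_completion u v x y) = 5"
  by (simp add: K4_completion_def doubleton_eq_iff)

lemma K4_completion_subset_nsets:
  "distinct [u, v, x, y] \<Longrightarrow> {u, v, x, y} \<subseteq> A \<Longrightarrow> K4_completion u v x y \<subseteq> nsets A 2"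
  by (simp add: K4_completion_def)

text \<open>Every edge of the first completion contains \<open>x\<close> or \<open>y\<close>, while
  the edges of the second stay inside \<open>{u, v, x', y'}\<close>.\<close>

lemma K4_completion_disjoint:
  assumes "x \<notin> {u, v, x', y'}" "y \<notin> {u, v, x', y'}"
  shows "K4_completion u v x y \<inter> K4_completion u v x' y' = {}"
proof -
  have "x \<in> e \<or> y \<in> e" if "e \<in> K4_completion u v x y" for e
    using that by (auto simp: K4_completion_def)
  moreover have "e \<subseteq> {u, v, x', y'}" if "e \<in> K4_completion u v x' y'" for e
    using that by (auto simp: K4_completion_def)
  ultimately show ?thesis using assms by blast
qed

lemma prob_no_K4_completion:
  assumes n: "n \<ge> 6" and uv: "u < n" "v < n" "u \<noteq> v"
  shows "measure_pmf.prob (gnp n (1/2))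
           {E. \<not> (\<exists>x<n. \<exists>y<n. distinct [u, v, x, y] \<and> K4_completion u v x y \<subseteq> E)}
           \<le> exp (- (real n - 5) / 1024)"
proof -
  \<comment> \<open>Only the pairs \<open>{2t, 2t + 1}\<close> are tried as \<open>{x, y}\<close>: their completions are disjoint, hence independent.\<close>
  define T where "T = {..<n div 2} - {u div 2, v div 2}"
  define S where "S = (\<lambda>t. K4_completion u v (2 * t) (2 * t + 1))"
  \<comment> \<open>At most two of the candidate pairs meet \<open>{u, v}\<close>; for
    \<open>n \<ge> 6\<close> at least one candidate remains.\<close>
  have "card {u div 2, v div 2} \<le> 2" by (simp add: card_insert_if)
  then have "n div 2 - 2 \<le> n div 2 - card {u div 2, v div 2}" by (rule diff_le_mono2)
  also have "\<dots> \<le> card T"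
    using diff_card_le_card_Diff[of "{u div 2, v div 2}" "{..<n div 2}"] by (simp add: T_def)
  finally have cT: "card T \<ge> n div 2 - 2" .
  have "card T > 0" using cT n by linarith
  then have T: "finite T" "T \<noteq> {}" by (simp_all add: card_gt_0_iff)
  have new: "2 * t \<notin> {u, v}" "2 * t + 1 \<notin> {u, v}" "2 * t + 1 < n" if "t \<in> T" for t
    using that by (auto simp: T_def)
  have dist: "distinct [u, v, 2 * t, 2 * t + 1]" if "t \<in> T" for t
    using new(1,2)[OF that] uv(3) by auto
  have "card (S t) = 5" if "t \<in> T" for t
    unfolding S_def by (rule card_K4_completion[OF dist[OF that]])
  moreover have "disjoint_family_on S T"
  proof (unfold disjoint_family_on_def, intro ballI impI)
    fix s t assume st: "s \<in> T" "t \<in> T" "s \<noteq> t"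
    have "2 * s \<notin> {2 * t, 2 * t + 1}" "2 * s + 1 \<notin> {2 * t, 2 * t + 1}"
      using st(3) by (safe; presburger)+
    with new[OF st(1)] show "S s \<inter> S t = {}"
      unfolding S_def by (intro K4_completion_disjoint) blast+
  qed
  moreover have "S t \<subseteq> nsets {..<n} 2" if "t \<in> T" for t
    unfolding S_def using new(3)[OF that] uv
    by (intro K4_completion_subset_nsets dist[OF that]) simp
  \<comment> \<open>Choosing \<open>\<epsilon> = 1/32 = (1/2) ^ 5\<close> puts the threshold at 0,
    so this lower tail is the event that no candidate pair completes \<open>{u, v}\<close>.\<close>
  ultimately have tail: "measure_pmf.prob (gnp n (1/2))
      {E. real (card {t \<in> T. S t \<subseteq> E}) \<le> ((1/2) ^ 5 - 1/32) * real (card T)}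
        \<le> exp (- 2 * (1/32)\<^sup>2 * real (card T))"
    by (intro gnp_count_tails T) auto
  have "measure_pmf.prob (gnp n (1/2))
           {E. \<not> (\<exists>x<n. \<exists>y<n. distinct [u, v, x, y] \<and> K4_completion u v x y \<subseteq> E)}
      \<le> measure_pmf.prob (gnp n (1/2))
      {E. real (card {t \<in> T. S t \<subseteq> E}) \<le> ((1/2) ^ 5 - 1/32) * real (card T)}"
  proof (rule measure_pmf.finite_measure_mono)
    show "{E. \<not> (\<exists>x<n. \<exists>y<n. distinct [u, v, x, y] \<and> K4_completion u v x y \<subseteq> E)}
      \<subseteq> {E. real (card {t \<in> T. S t \<subseteq> E}) \<le> ((1/2) ^ 5 - 1/32) * real (card T)}"
    proof
      fix E assume E: "E \<in> {E. \<not> (\<exists>x<n. \<exists>y<n. distinct [u, v, x, y] \<and> K4_completion u v x y \<subseteq> E)}"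
      have "\<not> S t \<subseteq> E" if "t \<in> T" for t
      proof -
        have "2 * t < n" using new(3)[OF that] by simp
        with new(3)[OF that] dist[OF that] E show ?thesis unfolding S_def by blast
      qed
      then have "{t \<in> T. S t \<subseteq> E} = {}" by blast
      then have none: "card {t \<in> T. S t \<subseteq> E} = 0" by (simp only: card.empty)
      then show "E \<in> {E. real (card {t \<in> T. S t \<subseteq> E}) \<le> ((1/2) ^ 5 - 1/32) * real (card T)}"
        unfolding mem_Collect_eq none by (simp add: power_divide)
    qed
  qed simp
  also note tail
  \<comment> \<open>\<open>card T \<ge> (n - 5) / 2\<close>, the worst case being odd
    \<open>n\<close>, and \<open>2 * (1/32)^2 = 1/512\<close>.\<close>
  also have "exp (- 2 * (1/32)\<^sup>2 * real (card T)) \<le> exp (- (real n - 5) / 1024)"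
    using cT by (simp add: power2_eq_square)
  finally show ?thesis .
qed

section \<open>Deterministic bounds for graphs with the typical properties\<close>

lemma edge_clique_order_ge4:
  assumes uv: "u < n" "v < n" and e: "{u, v} \<in> E"
    and xy: "x < n" "y < n" "distinct [u, v, x, y]" "K4_completion u v x y \<subseteq> E"
  shows "edge_clique_order n E {u, v} \<ge> 4"
proof -
  let ?C = "{card K |K. K \<subseteq> {..<n} \<and> clique K E \<and> {u, v} \<subseteq> K}"
  have "?C \<subseteq> {..n}" using card_mono[of "{..<n}"] by auto
  then have fin: "finite ?C" by (rule finite_subset) simp
  have "clique {u, v, x, y} E"
    using e xy(4) by (auto simp: clique_def K4_completion_def insert_commute)
  moreover have "card {u, v, x, y} = 4" using xy(3) by simp
  ultimately have "4 \<in> ?C"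
    using uv xy by (intro CollectI exI[of _ "{u, v, x, y}"]) auto
  then show ?thesis unfolding edge_clique_order_def using fin by (intro Max_ge)
qed

text \<open>Every edge lies in a 4-clique, and \<open>2 * (1 - 1/4) = 3/2\<close>.\<close>

lemma sum_edge_clique_order_ge:
  assumes E: "E \<subseteq> nsets {..<n} 2"
    and K4: "\<And>u v. u < n \<Longrightarrow> v < n \<Longrightarrow> u \<noteq> v \<Longrightarrow>
      \<exists>x<n. \<exists>y<n. distinct [u, v, x, y] \<and> K4_completion u v x y \<subseteq> E"
  shows "(\<Sum>e\<in>E. 2 * (1 - 1 / real (edge_clique_order n E e))) \<ge> 3/2 * real (card E)"
proof -
  have "3/2 \<le> 2 * (1 - 1 / real (edge_clique_order n E e))" if e: "e \<in> E" for e
  proof -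
    obtain u v where uv: "e = {u, v}" "u < n" "v < n" "u \<noteq> v"
      using e E unfolding nsets_2_eq by blast
    obtain x y where "x < n" "y < n" "distinct [u, v, x, y]" "K4_completion u v x y \<subseteq> E"
      using K4[OF uv(2-4)] by blast
    then have "4 \<le> edge_clique_order n E e"
      using edge_clique_order_ge4[OF uv(2,3)] e unfolding uv(1) by blast
    then show ?thesis by (simp add: field_simps)
  qed
  then have "(\<Sum>e\<in>E. 3/2) \<le> (\<Sum>e\<in>E. 2 * (1 - 1 / real (edge_clique_order n E e)))"
    by (rule sum_mono)
  then show ?thesis by simp
qed

text \<open>The \<open>n\<close> diagonal terms are bounded trivially by \<open>n\<close> squared
  each; together they give the cubic term, of lower order than the main one.\<close>

lemma sum_codegree_squares_le:
  assumes "\<And>i j. i < n \<Longrightarrow> j < n \<Longrightarrow> i \<noteq> j \<Longrightarrow> real (codegree n E i j) \<le> c * real n"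
  shows "(\<Sum>i<n. \<Sum>j<n. (real (codegree n E i j))\<^sup>2) \<le> c\<^sup>2 * real n ^ 4 + real n ^ 3"
proof -
  have "(real (codegree n E i j))\<^sup>2 \<le> c\<^sup>2 * (real n)\<^sup>2 + (if j = i then (real n)\<^sup>2 else 0)"
    if "i < n" "j < n" for i j
  proof (cases "j = i")
    case True
    have "codegree n E i j \<le> n"
      unfolding codegree_def
      using card_mono[of "{..<n}" "{k \<in> {..<n}. {i, k} \<in> E \<and> {j, k} \<in> E}"] by auto
    then have "(real (codegree n E i j))\<^sup>2 \<le> (real n)\<^sup>2" by (intro power_mono) auto
    with True show ?thesis by (simp add: add_increasing)
  next
    case False
    then have "(real (codegree n E i j))\<^sup>2 \<le> (c * real n)\<^sup>2"
      using assms[OF that] by (intro power_mono) auto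
    with False show ?thesis by (simp add: power_mult_distrib)
  qed
  then have "(\<Sum>i<n. \<Sum>j<n. (real (codegree n E i j))\<^sup>2)
      \<le> (\<Sum>i<n. \<Sum>j<n. c\<^sup>2 * (real n)\<^sup>2 + (if j = i then (real n)\<^sup>2 else 0))"
    by (intro sum_mono) auto
  also have "\<dots> = c\<^sup>2 * real n ^ 4 + real n ^ 3"
    by (simp add: sum.distrib power2_eq_square power4_eq_xxxx power3_eq_cube algebra_simps)
  finally show ?thesis .
qed

lemma eigenvalue_bound_of_pseudorandom:
  assumes n: "n \<ge> 300" and E: "E \<subseteq> nsets {..<n} 2"
    and edges: "real (card E) \<ge> 99/200 * real (n choose 2)"
    and codeg: "\<And>i j. i < n \<Longrightarrow> j < n \<Longrightarrow> i \<noteq> j \<Longrightarrow> real (codegree n E i j) \<le> 51/200 * real n"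
    and K4: "\<And>u v. u < n \<Longrightarrow> v < n \<Longrightarrow> u \<noteq> v \<Longrightarrow>
      \<exists>x<n. \<exists>y<n. distinct [u, v, x, y] \<and> K4_completion u v x y \<subseteq> E"
  shows "(adj_eigenvalue n E 1)\<^sup>2 + (adj_eigenvalue n E 2)\<^sup>2
           \<le> (\<Sum>e\<in>E. 2 * (1 - 1 / real (edge_clique_order n E e)))"
proof -
  define a b x where "a = (adj_eigenvalue n E 1)\<^sup>2" and "b = (adj_eigenvalue n E 2)\<^sup>2"
    and "x = real n"
  have x: "x \<ge> 300" using n by (simp add: x_def)
  have "a\<^sup>2 + b\<^sup>2 \<le> (51/200)\<^sup>2 * x ^ 4 + x ^ 3"
    using adj_eigenvalue_pow4_le[of n E] sum_codegree_squares_le[of n E "51/200", OF codeg] n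
    by (simp add: a_def b_def x_def flip: power_mult)
  moreover have "(a + b)\<^sup>2 \<le> 2 * (a\<^sup>2 + b\<^sup>2)"
    using sum_squares_ge_zero[of "a - b" 0] by (simp add: power2_eq_square algebra_simps)
  ultimately have "(a + b)\<^sup>2 \<le> 2 * ((51/200)\<^sup>2 * x ^ 4 + x ^ 3)"
    by (meson mult_left_mono order_trans zero_le_numeral)
  \<comment> \<open>The target is the clique side: \<open>297/800 * x * (x - 1)\<close> is
    \<open>3/2 * 99/200\<close> times the number of pairs. The leading coefficients satisfy
    \<open>(297/800)^2 > 2 * (51/200)^2\<close>, a perturbed form of 3/8 exceeding the square root
    of 1/8.\<close>
  also have "\<dots> \<le> (297/800 * (x * (x - 1)))\<^sup>2"
  proof -
    have expand: "(k * (x * (x - 1)))\<^sup>2 - 2 * (d\<^sup>2 * x ^ 4 + x ^ 3)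
        = x\<^sup>2 * ((k\<^sup>2 - 2 * d\<^sup>2) * x\<^sup>2 - 2 * (k\<^sup>2 + 1) * x + k\<^sup>2)" for k d :: real
      by (simp add: power2_eq_square power4_eq_xxxx power3_eq_cube algebra_simps)
    define c where "c = ((297/800)\<^sup>2 - 2 * (51/200)\<^sup>2 :: real)"
    have "(297/800 * (x * (x - 1)))\<^sup>2 - 2 * ((51/200)\<^sup>2 * x ^ 4 + x ^ 3)
        = x\<^sup>2 * (c * x\<^sup>2 - 2 * ((297/800)\<^sup>2 + 1) * x + (297/800)\<^sup>2)"
      unfolding c_def by (rule expand)
    \<comment> \<open>Here \<open>x \<ge> 300\<close> enters: \<open>c\<close> is positive but
      small, about 0.0078, and the inequality starts to hold a little below 300.\<close>
    moreover have "c * x\<^sup>2 \<ge> 2 * ((297/800)\<^sup>2 + 1) * x"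
      using x by (simp add: c_def power2_eq_square)
    then have "0 \<le> x\<^sup>2 * (c * x\<^sup>2 - 2 * ((297/800)\<^sup>2 + 1) * x + (297/800)\<^sup>2)"
      by (intro mult_nonneg_nonneg add_nonneg_nonneg) (simp_all only: diff_ge_0_iff_ge zero_le_power2)
    ultimately have "0 \<le> (297/800 * (x * (x - 1)))\<^sup>2 - 2 * ((51/200)\<^sup>2 * x ^ 4 + x ^ 3)"
      by (simp only:)
    then show ?thesis by (simp only: diff_ge_0_iff_ge)
  qed
  finally have "a + b \<le> 297/800 * (x * (x - 1))"
    by (rule power2_le_imp_le) (use x in simp)
  also have "\<dots> = 3/2 * (99/200 * real (n choose 2))"
    using n by (simp add: x_def choose_two real_of_nat_div of_nat_diff)
  also have "\<dots> \<le> 3/2 * real (card E)" using edges by simp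
  also have "\<dots> \<le> (\<Sum>e\<in>E. 2 * (1 - 1 / real (edge_clique_order n E e)))"
    by (rule sum_edge_clique_order_ge[OF E K4])
  finally show ?thesis by (simp add: a_def b_def)
qed

section \<open>Union bound and passage to the limit\<close>

theorem theorem4p6:
  shows "(\<lambda>n. measure_pmf.prob (gnp n (1/2))
            {E. (adj_eigenvalue n E 1)\<^sup>2 + (adj_eigenvalue n E 2)\<^sup>2
                  \<le> (\<Sum>e\<in>E. 2 * (1 - 1 / real (edge_clique_order n E e)))})
         \<longlonglongrightarrow> 1"
proof -
  define good where "good = (\<lambda>n. {E. (adj_eigenvalue n E 1)\<^sup>2 + (adj_eigenvalue n E 2)\<^sup>2
                  \<le> (\<Sum>e\<in>E. 2 * (1 - 1 / real (edge_clique_order n E e)))})"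
  \<comment> \<open>With \<open>\<delta> = exp (- (n - 5) / 20000)\<close> bounding each bad event,
    the at most \<open>n^2\<close> pairs contribute two events each, for codegree and completion.
    The third copy of \<open>n^2 * \<delta>\<close> generously covers the edge-count event.\<close>
  define err where "err n = 3 * ((real n)\<^sup>2 * exp (- (real n - 5) / 20000))" for n
  have lower: "1 - err n \<le> measure_pmf.prob (gnp n (1/2)) (good n)" if n: "n \<ge> 300" for n
  proof -
    let ?P = "measure_pmf.prob (gnp n (1/2))" and ?\<delta> = "exp (- (real n - 5) / 20000)"
    define pairs where "pairs = {(i, j). i < n \<and> j < n \<and> i \<noteq> j}"
    define B0 where "B0 = {E :: nat set set. real (card E) < 99/200 * real (n choose 2)}"
    define B1 where "B1 = (\<lambda>(i, j). {E. real (codegree n E i j) > 51/200 * real n})"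
    define B2 where "B2 = (\<lambda>(u, v). {E. \<not> (\<exists>x<n. \<exists>y<n. distinct [u, v, x, y] \<and> K4_completion u v x y \<subseteq> E)})"
    have pairs: "pairs \<subseteq> {..<n} \<times> {..<n}" by (auto simp: pairs_def)
    have fin: "finite pairs" by (rule finite_subset[OF pairs]) simp
    have "card pairs \<le> n\<^sup>2"
      using card_mono[OF _ pairs] by (simp add: card_cartesian_product power2_eq_square)
    then have card: "real (card pairs) \<le> (real n)\<^sup>2" by (metis of_nat_le_iff of_nat_power)
    \<comment> \<open>The inclusion is taken almost everywhere because the deterministic bound
      concerns edge sets of graphs on \<open>{..<n}\<close>, which is guaranteed on the
      support.\<close>
    have "?P (- good n) \<le> ?P (B0 \<union> (\<Union>q\<in>pairs. B1 q \<union> B2 q))"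
    proof (rule measure_pmf.finite_measure_mono_AE)
      show "AE E in gnp n (1/2). E \<in> - good n \<longrightarrow> E \<in> B0 \<union> (\<Union>q\<in>pairs. B1 q \<union> B2 q)"
      proof (rule AE_pmfI, rule impI, rule ccontr)
        fix E assume E: "E \<in> set_pmf (gnp n (1/2))" "E \<in> - good n"
          and nb: "E \<notin> B0 \<union> (\<Union>q\<in>pairs. B1 q \<union> B2 q)"
        have "E \<in> good n"
          unfolding good_def mem_Collect_eq
        proof (rule eigenvalue_bound_of_pseudorandom)
          show "n \<ge> 300" using n by simp
          show "E \<subseteq> nsets {..<n} 2" using E(1) set_pmf_gnp by blast
          show "real (card E) \<ge> 99/200 * real (n choose 2)" using nb by (simp add: B0_def)
          show "real (codegree n E i j) \<le> 51/200 * real n" if "i < n" "j < n" "i \<noteq> j" for i j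
          proof -
            have "(i, j) \<in> pairs" using that by (simp add: pairs_def)
            then have "E \<notin> B1 (i, j)" using nb by blast
            then show ?thesis by (simp add: B1_def)
          qed
          show "\<exists>x<n. \<exists>y<n. distinct [u, v, x, y] \<and> K4_completion u v x y \<subseteq> E"
            if "u < n" "v < n" "u \<noteq> v" for u v
          proof -
            have "(u, v) \<in> pairs" using that by (simp add: pairs_def)
            then have "E \<notin> B2 (u, v)" using nb by blast
            then show ?thesis by (simp add: B2_def)
          qed
        qed
        with E(2) show False by simp
      qed
    qed simp
    also have "\<dots> \<le> ?P B0 + ?P (\<Union>q\<in>pairs. B1 q \<union> B2 q)"
      by (rule measure_Un_le) auto
    also have "?P (\<Union>q\<in>pairs. B1 q \<union> B2 q) \<le> (\<Sum>q\<in>pairs. ?P (B1 q \<union> B2 q))"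
      by (rule measure_UNION_le[OF fin]) auto
    also have "\<dots> \<le> (\<Sum>q\<in>pairs. 2 * ?\<delta>)"
    proof (rule sum_mono)
      fix q assume "q \<in> pairs"
      then obtain i j where q: "q = (i, j)" "i < n" "j < n" "i \<noteq> j" by (auto simp: pairs_def)
      have "?P (B1 q \<union> B2 q) \<le> ?P (B1 q) + ?P (B2 q)"
        by (rule measure_Un_le) auto
      also have "\<dots> \<le> exp (- (real n - 2) / 20000) + exp (- (real n - 5) / 1024)"
        unfolding q(1) B1_def B2_def prod.case
        by (intro add_mono prob_codegree_large prob_no_K4_completion q) (use n in auto)
      also have "\<dots> \<le> ?\<delta> + ?\<delta>"
        using n by (intro add_mono) simp_all
      finally show "?P (B1 q \<union> B2 q) \<le> 2 * ?\<delta>" by simp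
    qed
    also have "\<dots> \<le> (real n)\<^sup>2 * (2 * ?\<delta>)"
      using card by (simp add: mult_right_mono)
    also have "?P B0 \<le> exp (- real (n choose 2) / 20000)"
      unfolding B0_def by (rule prob_few_edges) (use n in simp)
    also have "real (n choose 2) = real n * (real n - 1) / 2"
      using n by (simp add: choose_two real_of_nat_div of_nat_diff)
    \<comment> \<open>The quadratic exponent is weakened to the common linear rate by
      \<open>2 * (n - 5) \<le> n * (n - 1)\<close>.\<close>
    also have "exp (- (real n * (real n - 1) / 2) / 20000) \<le> 1 * ?\<delta>"
      using n mult_mono[of 2 "real n" "real n - 5" "real n - 1"] by simp
    also have "\<dots> \<le> (real n)\<^sup>2 * ?\<delta>"
      using n by (intro mult_right_mono) simp_all
    finally have "?P (- good n) \<le> err n" by (simp add: err_def)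
    moreover have "?P (- good n) = 1 - ?P (good n)"
      using measure_pmf.prob_compl[of "good n" "gnp n (1/2)"] by (simp add: Compl_eq_Diff_UNIV)
    ultimately show ?thesis by simp
  qed
  have "err \<longlonglongrightarrow> 0"
    unfolding err_def
    by (rule tendsto_mult_right_zero[OF square_times_exp_tendsto_0]) simp
  then have "(\<lambda>n. 1 - err n) \<longlonglongrightarrow> 1" by (auto intro!: tendsto_eq_intros)
  then have "(\<lambda>n. measure_pmf.prob (gnp n (1/2)) (good n)) \<longlonglongrightarrow> 1"
    by (rule tendsto_sandwich[rotated 2, OF _ tendsto_const])
      (auto intro!: eventually_mono[OF eventually_ge_at_top[of 300]] lower)
  then show ?thesis by (simp add: good_def)
qed

end
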